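(* Let $s_1,s_2$ be real numbers with $0\le s_1<s_2$ and let $t_1,t_2\in[0,1)$. Then $\mathfrak{A}_{s_2}^{t_2}\not\subset\mathfrak{A}_{s_1}^{t_1}$.
   Context: Let $\mathbb{D}=\{z\in\mathbb{C}:|z|<1\}$ and let $\mathcal{A}$ be the set of all holomorphic functions $f$ on $\mathbb{D}$ with $f(0)=0$ and $f'(0)=1$. For $s\in[0,\infty)$ and $t\in[0,1]$ define $$\mathfrak{A}_s^t:=\left\{f\in\mathcal{A}:\ \Re\left[(s-1)\frac{f(z)}{z}+f'(z)\right]\ge st\ \text{ for all } z\in\mathbb{D}\setminus\{0\}\right\}.$$ *)

theory Defs
  imports "HOL-Complex_Analysis.Complex_Analysis"
begin

text \<open>
  Functions on the unit disc are represented by total functions on the complex plane. All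
  conditions below depend only on the values on the open unit disc, so the values elsewhere
  are irrelevant.
\<close>

abbreviation unit_disc :: "complex set" where
  "unit_disc \<equiv> ball 0 1"

definition class_A :: "(complex \<Rightarrow> complex) set" where
  "class_A = {f. f holomorphic_on unit_disc \<and> f 0 = 0 \<and> deriv f 0 = 1}"

text \<open>Only the parameter range \<open>s \<ge> 0\<close> and \<open>0 \<le> t \<le> 1\<close> is intended.\<close>

definition class_A_st :: "real \<Rightarrow> real \<Rightarrow> (complex \<Rightarrow> complex) set" where
  "class_A_st s t =
     {f \<in> class_A. \<forall>z \<in> unit_disc - {0}.
        Re ((complex_of_real s - 1) * (f z / z) + deriv f z) \<ge> s * t}"

end

theory Submission
  imports Defs
begin

text \<open>
  Write \<open>f z = z * g z\<close>. The expression in the definition of the class becomes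
  \<open>L\<^sub>s g = s * g + z * g'\<close>, so that \<open>L\<^bsub>s1\<^esub> g = L\<^bsub>s2\<^esub> g - (s2 - s1) * g\<close>. It therefore suffices
  to find \<open>g\<close> with \<open>g 0 = 1\<close> such that \<open>Re (L\<^bsub>s2\<^esub> g)\<close> is bounded below by \<open>s2 * t2\<close>, while along
  some path \<open>Re (L\<^bsub>s2\<^esub> g)\<close> stays bounded and \<open>Re g\<close> tends to infinity: there \<open>Re (L\<^bsub>s1\<^esub> g)\<close>
  tends to minus infinity.

  A logarithmic singularity at \<open>1\<close> does this. If \<open>g\<close> behaves like \<open>- Ln (1 - z)\<close>, then
  \<open>z * g'\<close> contributes \<open>z / (1 - z)\<close>, whose real part exceeds \<open>- 1/2\<close> on the disc, and \<open>s2 * g\<close>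
  contributes \<open>- s2 * Ln (1 - z)\<close>. The latter is cancelled by adding the lower order term
  \<open>- s2 * (1 - z) * Ln (1 - z)\<close> to \<open>g\<close>; what remains of \<open>L\<^bsub>s2\<^esub> g\<close> is bounded because \<open>w * Ln w\<close>
  is bounded near \<open>0\<close> (lemmas \<open>norm_mult_Ln_le\<close> and \<open>operator_log_bump\<close>). A small positive
  factor \<open>a\<close> in front of the singular part brings the lower bound up to \<open>s2 * t2\<close>, which is
  possible because \<open>t2 < 1\<close> and \<open>s2 > 0\<close>.

  The path must be tangential to the unit circle, since \<open>z / (1 - z)\<close> would win over the logarithm
  along a radius. The circle \<open>1 / (1 - z) = 1 + \<i> * y\<close>, on which \<open>z / (1 - z) = \<i> * y\<close> is purely
  imaginary, is such a path.
\<close>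

text \<open>
  The inequality \<open>ln x \<le> x - 1\<close>, applied to \<open>norm w\<close> and to its inverse, controls the real part
  \<open>ln (norm w)\<close> of the logarithm from both sides; the imaginary part is at most \<open>pi\<close>, hence at
  most \<open>4\<close>, in absolute value.
\<close>

lemma norm_mult_Ln_le:
  assumes "w \<noteq> 0" and "norm w \<le> 2"
  shows "norm (w * Ln w) \<le> 10"
proof -
  let ?r = "norm w"
  have r: "?r > 0" using assms(1) by simp
  have "ln ?r \<le> ?r - 1" using r by (rule ln_le_minus_one)
  then have "ln ?r \<le> 1" using assms(2) by simp
  then have up: "?r * ln ?r \<le> 2"
    using mult_left_mono[of "ln ?r" 1 ?r] r assms(2) by linarith
  have "- ln ?r \<le> inverse ?r - 1"
    using ln_le_minus_one[of "inverse ?r"] r by (simp add: ln_inverse)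
  then have "?r * (- ln ?r) \<le> ?r * (inverse ?r - 1)"
    using r by (intro mult_left_mono) auto
  also have "\<dots> \<le> 2" using r by (simp add: field_simps)
  finally have re: "?r * \<bar>ln ?r\<bar> \<le> 2" using up by (simp add: abs_if)
  have "\<bar>Im (Ln w)\<bar> \<le> 4"
    using mpi_less_Im_Ln[OF assms(1)] Im_Ln_le_pi[OF assms(1)] pi_less_4 by linarith
  then have im: "?r * \<bar>Im (Ln w)\<bar> \<le> 2 * 4"
    using assms(2) by (intro mult_mono) auto
  have "norm (Ln w) \<le> \<bar>ln ?r\<bar> + \<bar>Im (Ln w)\<bar>"
    using cmod_le[of "Ln w"] assms(1) by simp
  then have "?r * norm (Ln w) \<le> ?r * (\<bar>ln ?r\<bar> + \<bar>Im (Ln w)\<bar>)"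
    by (rule mult_left_mono) simp
  also have "\<dots> \<le> 2 + 2 * 4" using re im by (simp add: distrib_left)
  finally show ?thesis by (simp add: norm_mult)
qed

lemma one_minus_unit_disc:
  assumes "z \<in> unit_disc"
  shows "1 - z \<noteq> 0" "norm (1 - z) \<le> 2" "1 - z \<notin> \<real>\<^sub>\<le>\<^sub>0"
proof -
  have n: "norm z < 1" using assms by simp
  then show "1 - z \<noteq> 0" by auto
  show "norm (1 - z) \<le> 2" using norm_triangle_ineq4[of 1 z] n by simp
  have "Re z < 1" using complex_Re_le_cmod[of z] n by linarith
  then show "1 - z \<notin> \<real>\<^sub>\<le>\<^sub>0" by (auto simp: complex_nonpos_Reals_iff)
qed

lemma Re_of_real_mult: "Re (of_real x * z) = x * Re z"
  by simp

lemma Re_div_one_minus_gt: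
  assumes "z \<in> unit_disc"
  shows "Re (z / (1 - z)) > - 1/2"
proof -
  have ne: "1 - z \<noteq> 0" using one_minus_unit_disc[OF assms] by blast
  \<comment> \<open>The right-hand side is half of the positive real part of the Cayley transform of \<open>z\<close>.\<close>
  have "Re (z / (1 - z)) + 1/2 = Re ((1 + z) / (1 - z)) / 2"
  proof -
    have "z / (1 - z) + of_real (1/2) = of_real (1/2) * ((1 + z) / (1 - z))"
      using ne by (simp add: field_simps)
    then have "Re (z / (1 - z) + of_real (1/2)) = Re (of_real (1/2) * ((1 + z) / (1 - z)))"
      by (rule arg_cong)
    then show ?thesis unfolding Re_of_real_mult plus_complex.sel Re_complex_of_real by simp
  qed
  also have "Re ((1 + z) / (1 - z)) = (1 - (norm z)\<^sup>2) / (norm (1 - z))\<^sup>2"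
    unfolding cmod_power2 Re_divide by (simp add: power2_eq_square algebra_simps)
  also have "(1 - (norm z)\<^sup>2) / (norm (1 - z))\<^sup>2 / 2 > 0"
    using ne assms by (simp add: power_less_one_iff abs_square_less_1)
  finally show ?thesis by simp
qed

text \<open>
  The term with factor \<open>s\<close> is the correction that cancels the logarithm in
  \<open>s * g + z * g'\<close>, where \<open>g\<close> is the function \<open>log_bump s a\<close>.
\<close>

definition log_bump :: "real \<Rightarrow> real \<Rightarrow> complex \<Rightarrow> complex" where
  "log_bump s a z = 1 - of_real a * (Ln (1 - z) + of_real s * ((1 - z) * Ln (1 - z)))"

lemma has_field_derivative_log_bump:
  assumes "z \<in> unit_disc"
  shows "(log_bump s a has_field_derivative
           of_real a * (1 / (1 - z) + of_real s * (Ln (1 - z) + 1))) (at z)"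
  unfolding log_bump_def
proof -
  have ne: "1 - z \<noteq> 0" "1 - z \<notin> \<real>\<^sub>\<le>\<^sub>0" using one_minus_unit_disc[OF assms] by auto
  have l: "((\<lambda>z. Ln (1 - z)) has_field_derivative - (1 / (1 - z))) (at z)"
    using ne by (auto intro!: derivative_eq_intros simp: field_simps)
  have "((\<lambda>z. (1 - z) * Ln (1 - z)) has_field_derivative - (Ln (1 - z) + 1)) (at z)"
    by (rule DERIV_cong[OF DERIV_mult[OF DERIV_diff[OF DERIV_const DERIV_ident] l]])
      (use ne in simp)
  from DERIV_diff[OF DERIV_const DERIV_cmult[OF DERIV_add[OF l DERIV_cmult[OF this]]]]
  show "((\<lambda>z. 1 - of_real a * (Ln (1 - z) + of_real s * ((1 - z) * Ln (1 - z))))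
      has_field_derivative of_real a * (1 / (1 - z) + of_real s * (Ln (1 - z) + 1))) (at z)"
    by (rule DERIV_cong) (simp add: algebra_simps)
qed

lemma has_field_derivative_times_log_bump:
  assumes "z \<in> unit_disc"
  shows "((\<lambda>z. z * log_bump s a z) has_field_derivative log_bump s a z +
           z * (of_real a * (1 / (1 - z) + of_real s * (Ln (1 - z) + 1)))) (at z)"
  using DERIV_mult[OF DERIV_ident has_field_derivative_log_bump[OF assms, of s a]]
  by (simp add: algebra_simps)

lemma times_log_bump_in_class_A: "(\<lambda>z. z * log_bump s a z) \<in> class_A"
proof -
  have "(\<lambda>z. z * log_bump s a z) holomorphic_on unit_disc"
    by (subst holomorphic_on_open) (auto intro: has_field_derivative_times_log_bump)
  moreover have "deriv (\<lambda>z. z * log_bump s a z) 0 = 1"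
    by (rule DERIV_imp_deriv[OF has_field_derivative_times_log_bump[of 0, THEN DERIV_cong]])
      (auto simp: log_bump_def)
  ultimately show ?thesis by (simp add: class_A_def)
qed

text \<open>
  With the parameter \<open>s\<close> of the operator equal to that of \<open>log_bump\<close>, the summands \<open>Ln (1 - z)\<close>
  combine to \<open>(1 - z) * Ln (1 - z)\<close>; for another parameter \<open>r\<close> a multiple of the unbounded
  function \<open>log_bump s a\<close> itself is left over.
\<close>

lemma operator_log_bump:
  assumes "z \<in> unit_disc - {0}"
  shows "(of_real r - 1) * (z * log_bump s a z / z) + deriv (\<lambda>z. z * log_bump s a z) z =
    of_real s + of_real a * (z / (1 - z) + of_real s * z
      - of_real (s * (1 + s)) * ((1 - z) * Ln (1 - z)))
    - of_real (s - r) * log_bump s a z"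
proof -
  have z: "z \<in> unit_disc" "z \<noteq> 0" using assms by auto
  have d: "deriv (\<lambda>z. z * log_bump s a z) z = log_bump s a z +
           z * (of_real a * (1 / (1 - z) + of_real s * (Ln (1 - z) + 1)))"
    by (rule DERIV_imp_deriv[OF has_field_derivative_times_log_bump[OF z(1)]])
  have "z * log_bump s a z / z = log_bump s a z" using z(2) by simp
  then show ?thesis
    unfolding d by (simp only: log_bump_def) (simp add: algebra_simps)
qed

lemma bounded_part_le:
  assumes "z \<in> unit_disc" and "0 \<le> s"
  shows "\<bar>Re (of_real s * z - of_real (s * (1 + s)) * ((1 - z) * Ln (1 - z)))\<bar>
           \<le> s + s * (1 + s) * 10"
proof -
  let ?A = "of_real s * z" and ?B = "of_real (s * (1 + s)) * ((1 - z) * Ln (1 - z))"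
  have "norm ?A \<le> s"
    using assms mult_left_le[of "norm z" s] by (simp add: norm_mult)
  moreover have "norm ?B = s * (1 + s) * norm ((1 - z) * Ln (1 - z))"
    unfolding norm_mult[of "of_real _"] norm_of_real using assms(2) by simp
  then have "norm ?B \<le> s * (1 + s) * 10"
    using norm_mult_Ln_le[OF one_minus_unit_disc(1,2)[OF assms(1)]] assms(2)
    by (simp add: mult_left_mono)
  ultimately have "norm (?A - ?B) \<le> s + s * (1 + s) * 10"
    using norm_triangle_ineq4[of ?A ?B] by linarith
  then show ?thesis using abs_Re_le_cmod order_trans by blast
qed

lemma times_log_bump_in_class_A_st:
  assumes "0 \<le> s" and "0 \<le> a" and "a * (1/2 + (s + s * (1 + s) * 10)) \<le> s * (1 - t)"
  shows "(\<lambda>z. z * log_bump s a z) \<in> class_A_st s t"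
proof -
  have "Re ((of_real s - 1) * (z * log_bump s a z / z) + deriv (\<lambda>z. z * log_bump s a z) z)
          \<ge> s * t" if z: "z \<in> unit_disc - {0}" for z
  proof -
    let ?B = "of_real s * z - of_real (s * (1 + s)) * ((1 - z) * Ln (1 - z))"
    have "Re (z / (1 - z)) + Re ?B \<ge> - (1/2 + (s + s * (1 + s) * 10))"
      using Re_div_one_minus_gt[of z] bounded_part_le[of z s] z assms(1) by fastforce
    then have "a * (Re (z / (1 - z)) + Re ?B) \<ge> a * - (1/2 + (s + s * (1 + s) * 10))"
      using assms(2) by (rule mult_left_mono)
    then have "s + a * (Re (z / (1 - z)) + Re ?B) \<ge> s * t"
      using assms(3) by (simp add: algebra_simps)
    moreover have "Re (of_real s + of_real a * (z / (1 - z) + ?B)) =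
        s + a * (Re (z / (1 - z)) + Re ?B)"
      by (simp only: plus_complex.sel Re_complex_of_real Re_of_real_mult)
    ultimately show ?thesis
      unfolding operator_log_bump[OF z] by (simp add: add_diff_eq)
  qed
  then show ?thesis
    using times_log_bump_in_class_A by (auto simp: class_A_st_def)
qed

text \<open>
  The point \<open>z\<close> with \<open>1 / (1 - z) = 1 + \<i> * exp C\<close> works: its distance from \<open>1\<close> is less than
  \<open>exp (- C)\<close>.
\<close>

lemma exists_tangential_point:
  fixes C :: real
  obtains z where "z \<in> unit_disc - {0}" "Re (z / (1 - z)) = 0" "C < - ln (norm (1 - z))"
proof -
  define v where "v = Complex 1 (exp C)"
  define z where "z = 1 - 1 / v"
  have v: "v \<noteq> 0" "v \<noteq> 1" by (auto simp: v_def complex_eq_iff)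
  have nv: "norm v = sqrt (1 + (exp C)\<^sup>2)" by (simp add: v_def cmod_def)
  have "exp C = sqrt ((exp C)\<^sup>2)" by simp
  also have "\<dots> < norm v" unfolding nv by (rule real_sqrt_less_mono) simp
  finally have lt: "exp C < norm v" .
  have eq: "z = (v - 1) / v" using v by (simp add: z_def field_simps)
  have "norm (v - 1) = exp C" by (simp add: v_def cmod_def)
  then have "norm z < 1" using lt v by (simp add: eq norm_divide)
  moreover have "z \<noteq> 0" using v by (simp add: eq)
  moreover have w: "1 - z = 1 / v" by (simp add: z_def)
  then have "z / (1 - z) = v - 1" using v by (simp add: eq)
  then have "Re (z / (1 - z)) = 0" by (simp add: v_def)
  moreover have "C < ln (norm v)"
    using lt by (metis exp_gt_zero ln_exp ln_less_cancel_iff order_less_trans)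
  then have "C < - ln (norm (1 - z))" using v by (simp add: w norm_divide ln_div)
  ultimately show ?thesis using that by simp
qed

lemma times_log_bump_notin_class_A_st:
  assumes "0 \<le> s" and "0 < a" and "r < s" and "0 \<le> r * t"
  shows "(\<lambda>z. z * log_bump s a z) \<notin> class_A_st r t"
proof
  assume mem: "(\<lambda>z. z * log_bump s a z) \<in> class_A_st r t"
  define R where "R = s + s * (1 + s) * 10"
  \<comment> \<open>Chosen so that \<open>(s - r) * (a * (C - s * 10))\<close> equals the upper bound \<open>s + a * R\<close>
      of the bounded part.\<close>
  define C where "C = (s + a * R) / ((s - r) * a) + s * 10"
  obtain z where z: "z \<in> unit_disc - {0}" and Re0: "Re (z / (1 - z)) = 0"
    and C: "C < - ln (norm (1 - z))"
    by (rule exists_tangential_point)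
  let ?B = "of_real s * z - of_real (s * (1 + s)) * ((1 - z) * Ln (1 - z))"
  let ?W = "(1 - z) * Ln (1 - z)"
  have zd: "z \<in> unit_disc" using z by simp
  have B: "a * Re ?B \<le> a * R"
    using bounded_part_le[OF zd assms(1)] assms(2) unfolding R_def
    by (intro mult_left_mono) linarith+
  have W: "s * Re ?W \<le> s * 10"
    using norm_mult_Ln_le[OF one_minus_unit_disc(1,2)[OF zd]] complex_Re_le_cmod[of ?W] assms(1)
    by (intro mult_left_mono) linarith+
  have "Re (log_bump s a z) = 1 - a * (Re (Ln (1 - z)) + s * Re ?W)"
    unfolding log_bump_def by (simp only: minus_complex.sel one_complex.sel Re_of_real_mult
        plus_complex.sel)
  also have "Re (Ln (1 - z)) = ln (norm (1 - z))"
    using one_minus_unit_disc(1)[OF zd] by simp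
  finally have g: "Re (log_bump s a z) = 1 - a * (ln (norm (1 - z)) + s * Re ?W)" .
  have "a * (C - s * 10) \<le> a * (- (ln (norm (1 - z)) + s * Re ?W))"
    using C W assms(2) by (intro mult_left_mono) linarith+
  then have "a * (C - s * 10) < Re (log_bump s a z)" unfolding g by linarith
  then have "(s - r) * (a * (C - s * 10)) < (s - r) * Re (log_bump s a z)"
    using assms(3) by (intro mult_strict_left_mono) auto
  moreover have "(s - r) * (a * (C - s * 10)) = s + a * R"
    using assms(2,3) by (simp add: C_def)
  ultimately have "s + a * Re ?B - (s - r) * Re (log_bump s a z) < 0"
    using B by linarith
  moreover have "Re (of_real s + of_real a * (z / (1 - z) + ?B) - of_real (s - r) * log_bump s a z)
      = s + a * (Re (z / (1 - z)) + Re ?B) - (s - r) * Re (log_bump s a z)"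
    by (simp only: plus_complex.sel minus_complex.sel Re_complex_of_real Re_of_real_mult)
  moreover have "r * t \<le> Re ((of_real r - 1) * (z * log_bump s a z / z)
      + deriv (\<lambda>z. z * log_bump s a z) z)"
    using mem z unfolding class_A_st_def by blast
  then have "r * t \<le> Re (of_real s + of_real a * (z / (1 - z) + ?B)
      - of_real (s - r) * log_bump s a z)"
    unfolding operator_log_bump[OF z] by (simp only: add_diff_eq)
  ultimately show False using Re0 assms(4) by simp
qed

theorem theorem3p2:
  fixes s1 s2 t1 t2 :: real
  assumes "0 \<le> s1" and "s1 < s2"
    and "t1 \<in> {0..<1}" and "t2 \<in> {0..<1}"
  shows "\<not> class_A_st s2 t2 \<subseteq> class_A_st s1 t1"
proof -
  define K where "K = 1/2 + (s2 + s2 * (1 + s2) * 10)"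
  define a where "a = s2 * (1 - t2) / K"
  have s2: "0 < s2" using assms by simp
  then have K: "0 < K" unfolding K_def by (intro add_pos_pos mult_pos_pos) auto
  then have a: "0 < a" using s2 assms(4) by (simp add: a_def)
  have "a * K = s2 * (1 - t2)" using K by (simp add: a_def)
  then have "(\<lambda>z. z * log_bump s2 a z) \<in> class_A_st s2 t2"
    using s2 a by (intro times_log_bump_in_class_A_st) (auto simp: K_def)
  moreover have "(\<lambda>z. z * log_bump s2 a z) \<notin> class_A_st s1 t1"
    using assms s2 a by (intro times_log_bump_notin_class_A_st) auto
  ultimately show ?thesis by blast
qed

end
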